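(* Let $(\mathcal{E},\mathcal{M})$ be a quasi factorization structure in a category $\mathcal{X}$. (a) If $\mathcal{M}$ has $\mathcal{X}$-pullbacks, then $\mathcal{X}$ has quasi right $\mathcal{M}$-factorizations. (b) If every morphism in $\mathcal{M}$ is a monomorphism and $\mathcal{E}$ has $\mathcal{X}$-pushouts, then $\mathcal{X}$ has quasi left $\mathcal{E}$-factorizations.
   Context: For a morphism $f$, $\langle f\rangle=\{fh : h\in\mathcal{X},\ fh\text{ defined}\}$. For morphisms $f,g$ with the same codomain, $f\leqslant g$ means $\langle f\rangle\subseteq\langle g\rangle$, and $f\sim g$ means $f\leqslant g$ and $g\leqslant f$. $\mathcal{X}$ has quasi right $\mathcal{M}$-factorizations if for every morphism $f:Y\to X$ there is $m_f\in\mathcal{M}$ with codomain $X$ such that (a) $f=m_fg$ for some $g$; (b) if $m\in\mathcal{M}$ has codomain $X$ and $f=mg$ for some $g$, then $m_f=mh$ for some $h$. Dually, $\mathcal{X}$ has quasi left $\mathcal{E}$-factorizations if for every morphism $f:Y\to X$ there is $e_f\in\mathcal{E}$ with domain $Y$ such that (a) $f=ge_f$ for some $g$; (b) if $e\in\mathcal{E}$ has domain $Y$ and $f=ge$ for some $g$, then $e_f=he$ for some $h$. For $e:E\to X$ and $m:M\to X$, write $e\downarrow m$ if: whenever $e=mu$ for some $u:E\to M$, there is $w:X\to M$ with $mw\sim 1_X$. For $e:M\to E$ and $m:M\to X$, write $e\uparrow m$ if: for every $v:E\to X$ with $ve=m$ there is $w:E\to M$ with $mw\sim v$. For a class $\mathcal{H}$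 of morphisms, ${}^{\downarrow}\mathcal{H}$ is the class of all morphisms $e$ with $e\downarrow h$ for all $h\in\mathcal{H}$ with the same codomain as $e$, and $\mathcal{H}^{\uparrow}$ is the class of all morphisms $m$ with $h\uparrow m$ for all $h\in\mathcal{H}$ with the same domain as $m$. A quasi factorization structure in $\mathcal{X}$ is a pair $(\mathcal{E},\mathcal{M})$ of classes of morphisms such that (a) every morphism $f$ factors as $f=me$ with $e\in\mathcal{E}$, $m\in\mathcal{M}$; (b) $\mathcal{E}\subseteq{}^{\downarrow}\mathcal{M}$ and $\mathcal{M}\subseteq\mathcal{E}^{\uparrow}$. $\mathcal{M}$ has $\mathcal{X}$-pullbacks if for all $m\in\mathcal{M}$ and all morphisms $f$ of $\mathcal{X}$ with the same codomain as $m$, the pullback $f^{-1}(m)$ of $m$ along $f$ exists and is in $\mathcal{M}$. $\mathcal{E}$ has $\mathcal{X}$-pushouts if for all $e\in\mathcal{E}$ and all morphisms $f$ with the same domain as $e$, the pushout of $e$ along $f$ exists and is in $\mathcal{E}$. *)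

theory Defs
  imports Main
begin

record ('o, 'a) cat =
  Obj :: "'o set"
  Arr :: "'a set"
  Dom :: "'a \<Rightarrow> 'o"
  Cod :: "'a \<Rightarrow> 'o"
  Id  :: "'o \<Rightarrow> 'a"
  Comp :: "'a \<Rightarrow> 'a \<Rightarrow> 'a"  (infixl "\<cdot>\<index>" 70)

text \<open>Composition is written in applicative order: \<open>g \<cdot>\<^bsub>\<X>\<^esub> f\<close> is \<open>f\<close> followed by \<open>g\<close>, and it is
  meaningful only when \<open>Cod \<X> f = Dom \<X> g\<close>.\<close>

definition hom :: "('o, 'a, 'z) cat_scheme \<Rightarrow> 'o \<Rightarrow> 'o \<Rightarrow> 'a set" where
  "hom \<X> A B = {f \<in> Arr \<X>. Dom \<X> f = A \<and> Cod \<X> f = B}"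

locale category =
  fixes \<X> :: "('o, 'a, 'z) cat_scheme" (structure)
  assumes Dom_Obj: "f \<in> Arr \<X> \<Longrightarrow> Dom \<X> f \<in> Obj \<X>"
    and Cod_Obj: "f \<in> Arr \<X> \<Longrightarrow> Cod \<X> f \<in> Obj \<X>"
    and Id_hom: "A \<in> Obj \<X> \<Longrightarrow> Id \<X> A \<in> hom \<X> A A"
    and Comp_hom: "\<lbrakk>f \<in> hom \<X> A B; g \<in> hom \<X> B D\<rbrakk> \<Longrightarrow> g \<cdot> f \<in> hom \<X> A D"
    and Id_left: "f \<in> hom \<X> A B \<Longrightarrow> Id \<X> B \<cdot> f = f"
    and Id_right: "f \<in> hom \<X> A B \<Longrightarrow> f \<cdot> Id \<X> A = f"
    and Comp_assoc: "\<lbrakk>f \<in> hom \<X> A B; g \<in> hom \<X> B D; h \<in> hom \<X> D F\<rbrakk>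
      \<Longrightarrow> (h \<cdot> g) \<cdot> f = h \<cdot> (g \<cdot> f)"

definition monomorphism :: "('o, 'a, 'z) cat_scheme \<Rightarrow> 'a \<Rightarrow> bool" where
  "monomorphism \<X> m \<longleftrightarrow> m \<in> Arr \<X> \<and>
     (\<forall>A. \<forall>f \<in> hom \<X> A (Dom \<X> m). \<forall>g \<in> hom \<X> A (Dom \<X> m).
        m \<cdot>\<^bsub>\<X>\<^esub> f = m \<cdot>\<^bsub>\<X>\<^esub> g \<longrightarrow> f = g)"

text \<open>\<open>is_pullback \<X> m f p q\<close>: the morphism \<open>p\<close>, parallel to \<open>m\<close> in the square
  \<open>f p = m q\<close>, is a pullback of \<open>m\<close> along \<open>f\<close>.\<close>

definition is_pullback :: "('o, 'a, 'z) cat_scheme \<Rightarrow> 'a \<Rightarrow> 'a \<Rightarrow> 'a \<Rightarrow> 'a \<Rightarrow> bool" where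
  "is_pullback \<X> m f p q \<longleftrightarrow>
     m \<in> Arr \<X> \<and> f \<in> Arr \<X> \<and> Cod \<X> f = Cod \<X> m \<and>
     p \<in> hom \<X> (Dom \<X> p) (Dom \<X> f) \<and> q \<in> hom \<X> (Dom \<X> p) (Dom \<X> m) \<and>
     f \<cdot>\<^bsub>\<X>\<^esub> p = m \<cdot>\<^bsub>\<X>\<^esub> q \<and>
     (\<forall>T. \<forall>a \<in> hom \<X> T (Dom \<X> f). \<forall>b \<in> hom \<X> T (Dom \<X> m). f \<cdot>\<^bsub>\<X>\<^esub> a = m \<cdot>\<^bsub>\<X>\<^esub> b \<longrightarrow>
        (\<exists>!u. u \<in> hom \<X> T (Dom \<X> p) \<and> p \<cdot>\<^bsub>\<X>\<^esub> u = a \<and> q \<cdot>\<^bsub>\<X>\<^esub> u = b))"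

text \<open>Dually, \<open>is_pushout \<X> e f p q\<close>: the morphism \<open>p\<close>, parallel to \<open>e\<close> in the square
  \<open>p f = q e\<close>, is a pushout of \<open>e\<close> along \<open>f\<close>.\<close>

definition is_pushout :: "('o, 'a, 'z) cat_scheme \<Rightarrow> 'a \<Rightarrow> 'a \<Rightarrow> 'a \<Rightarrow> 'a \<Rightarrow> bool" where
  "is_pushout \<X> e f p q \<longleftrightarrow>
     e \<in> Arr \<X> \<and> f \<in> Arr \<X> \<and> Dom \<X> f = Dom \<X> e \<and>
     p \<in> hom \<X> (Cod \<X> f) (Cod \<X> p) \<and> q \<in> hom \<X> (Cod \<X> e) (Cod \<X> p) \<and>
     p \<cdot>\<^bsub>\<X>\<^esub> f = q \<cdot>\<^bsub>\<X>\<^esub> e \<and>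
     (\<forall>T. \<forall>a \<in> hom \<X> (Cod \<X> f) T. \<forall>b \<in> hom \<X> (Cod \<X> e) T. a \<cdot>\<^bsub>\<X>\<^esub> f = b \<cdot>\<^bsub>\<X>\<^esub> e \<longrightarrow>
        (\<exists>!u. u \<in> hom \<X> (Cod \<X> p) T \<and> u \<cdot>\<^bsub>\<X>\<^esub> p = a \<and> u \<cdot>\<^bsub>\<X>\<^esub> q = b))"

text \<open>Classes of morphisms need not be closed under isomorphism, so ``the pullback (pushout)
  exists and is in the class'' is read as: some pullback (pushout) is in the class.\<close>

definition has_pullbacks :: "('o, 'a, 'z) cat_scheme \<Rightarrow> 'a set \<Rightarrow> bool" where
  "has_pullbacks \<X> \<M> \<longleftrightarrow>
     (\<forall>m \<in> \<M>. \<forall>f \<in> Arr \<X>. Cod \<X> f = Cod \<X> m \<longrightarrow> (\<exists>p q. is_pullback \<X> m f p q \<and> p \<in> \<M>))"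

definition has_pushouts :: "('o, 'a, 'z) cat_scheme \<Rightarrow> 'a set \<Rightarrow> bool" where
  "has_pushouts \<X> \<E> \<longleftrightarrow>
     (\<forall>e \<in> \<E>. \<forall>f \<in> Arr \<X>. Dom \<X> f = Dom \<X> e \<longrightarrow> (\<exists>p q. is_pushout \<X> e f p q \<and> p \<in> \<E>))"

definition sieve :: "('o, 'a, 'z) cat_scheme \<Rightarrow> 'a \<Rightarrow> 'a set" where
  "sieve \<X> f = {f \<cdot>\<^bsub>\<X>\<^esub> h | h. h \<in> Arr \<X> \<and> Cod \<X> h = Dom \<X> f}"

definition mor_le :: "('o, 'a, 'z) cat_scheme \<Rightarrow> 'a \<Rightarrow> 'a \<Rightarrow> bool" where
  "mor_le \<X> f g \<longleftrightarrow> f \<in> Arr \<X> \<and> g \<in> Arr \<X> \<and> Cod \<X> f = Cod \<X> g \<and> sieve \<X> f \<subseteq> sieve \<X> g"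

definition mor_sim :: "('o, 'a, 'z) cat_scheme \<Rightarrow> 'a \<Rightarrow> 'a \<Rightarrow> bool" where
  "mor_sim \<X> f g \<longleftrightarrow> mor_le \<X> f g \<and> mor_le \<X> g f"

text \<open>The relations \<open>e \<down> m\<close> (used only when \<open>e\<close> and \<open>m\<close> have the same codomain) and
  \<open>e \<up> m\<close> (used only when they have the same domain).\<close>

definition down_rel :: "('o, 'a, 'z) cat_scheme \<Rightarrow> 'a \<Rightarrow> 'a \<Rightarrow> bool" where
  "down_rel \<X> e m \<longleftrightarrow>
     ((\<exists>u \<in> hom \<X> (Dom \<X> e) (Dom \<X> m). e = m \<cdot>\<^bsub>\<X>\<^esub> u) \<longrightarrow>
      (\<exists>w \<in> hom \<X> (Cod \<X> m) (Dom \<X> m). mor_sim \<X> (m \<cdot>\<^bsub>\<X>\<^esub> w) (Id \<X> (Cod \<X> m))))"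

definition up_rel :: "('o, 'a, 'z) cat_scheme \<Rightarrow> 'a \<Rightarrow> 'a \<Rightarrow> bool" where
  "up_rel \<X> e m \<longleftrightarrow>
     (\<forall>v \<in> hom \<X> (Cod \<X> e) (Cod \<X> m). v \<cdot>\<^bsub>\<X>\<^esub> e = m \<longrightarrow>
        (\<exists>w \<in> hom \<X> (Cod \<X> e) (Dom \<X> m). mor_sim \<X> (m \<cdot>\<^bsub>\<X>\<^esub> w) v))"

definition down_class :: "('o, 'a, 'z) cat_scheme \<Rightarrow> 'a set \<Rightarrow> 'a set" where
  "down_class \<X> \<H> = {e \<in> Arr \<X>. \<forall>h \<in> \<H>. Cod \<X> h = Cod \<X> e \<longrightarrow> down_rel \<X> e h}"

definition up_class :: "('o, 'a, 'z) cat_scheme \<Rightarrow> 'a set \<Rightarrow> 'a set" where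
  "up_class \<X> \<H> = {m \<in> Arr \<X>. \<forall>h \<in> \<H>. Dom \<X> h = Dom \<X> m \<longrightarrow> up_rel \<X> h m}"

definition quasi_factorization_structure ::
    "('o, 'a, 'z) cat_scheme \<Rightarrow> 'a set \<Rightarrow> 'a set \<Rightarrow> bool" where
  "quasi_factorization_structure \<X> \<E> \<M> \<longleftrightarrow>
     \<E> \<subseteq> Arr \<X> \<and> \<M> \<subseteq> Arr \<X> \<and>
     (\<forall>f \<in> Arr \<X>. \<exists>e \<in> \<E>. \<exists>m \<in> \<M>. Cod \<X> e = Dom \<X> m \<and> f = m \<cdot>\<^bsub>\<X>\<^esub> e) \<and>
     \<E> \<subseteq> down_class \<X> \<M> \<and> \<M> \<subseteq> up_class \<X> \<E>"

definition quasi_right_factorizations :: "('o, 'a, 'z) cat_scheme \<Rightarrow> 'a set \<Rightarrow> bool" where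
  "quasi_right_factorizations \<X> \<M> \<longleftrightarrow>
     (\<forall>f \<in> Arr \<X>. \<exists>m\<^sub>f \<in> \<M>. Cod \<X> m\<^sub>f = Cod \<X> f \<and>
        (\<exists>g \<in> hom \<X> (Dom \<X> f) (Dom \<X> m\<^sub>f). f = m\<^sub>f \<cdot>\<^bsub>\<X>\<^esub> g) \<and>
        (\<forall>m \<in> \<M>. Cod \<X> m = Cod \<X> f \<and> (\<exists>g \<in> hom \<X> (Dom \<X> f) (Dom \<X> m). f = m \<cdot>\<^bsub>\<X>\<^esub> g) \<longrightarrow>
           (\<exists>h \<in> hom \<X> (Dom \<X> m\<^sub>f) (Dom \<X> m). m\<^sub>f = m \<cdot>\<^bsub>\<X>\<^esub> h)))"

definition quasi_left_factorizations :: "('o, 'a, 'z) cat_scheme \<Rightarrow> 'a set \<Rightarrow> bool" where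
  "quasi_left_factorizations \<X> \<E> \<longleftrightarrow>
     (\<forall>f \<in> Arr \<X>. \<exists>e\<^sub>f \<in> \<E>. Dom \<X> e\<^sub>f = Dom \<X> f \<and>
        (\<exists>g \<in> hom \<X> (Cod \<X> e\<^sub>f) (Cod \<X> f). f = g \<cdot>\<^bsub>\<X>\<^esub> e\<^sub>f) \<and>
        (\<forall>e \<in> \<E>. Dom \<X> e = Dom \<X> f \<and> (\<exists>g \<in> hom \<X> (Cod \<X> e) (Cod \<X> f). f = g \<cdot>\<^bsub>\<X>\<^esub> e) \<longrightarrow>
           (\<exists>h \<in> hom \<X> (Cod \<X> e) (Cod \<X> e\<^sub>f). e\<^sub>f = h \<cdot>\<^bsub>\<X>\<^esub> e)))"

end

theory Submission
  imports Defs
begin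

text \<open>
  Any \<open>(\<E>, \<M>)\<close>-factorization \<open>f = m\<^sub>0 e\<^sub>0\<close> of \<open>f\<close> supplies both universal factorizations: \<open>m\<^sub>0\<close> is
  the quasi right \<open>\<M>\<close>-factor of \<open>f\<close> and \<open>e\<^sub>0\<close> is its quasi left \<open>\<E>\<close>-factor.

  For (a), let \<open>f = m g\<close> with \<open>m \<in> \<M>\<close>, and let \<open>p\<close> be a pullback of \<open>m\<close> along \<open>m\<^sub>0\<close> that lies in
  \<open>\<M>\<close>. Since \<open>m\<^sub>0 e\<^sub>0 = m g\<close>, the morphism \<open>e\<^sub>0 \<in> \<E>\<close> factors through \<open>p \<in> \<M>\<close>, and \<open>e\<^sub>0 \<down> p\<close> then
  forces \<open>p\<close> to have a section (\<open>section_of_down_rel\<close>). A section of the pullback of \<open>m\<close> along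
  \<open>m\<^sub>0\<close> is the same thing as a factorization of \<open>m\<^sub>0\<close> through \<open>m\<close>.

  For (b), let \<open>f = g e\<close> with \<open>e \<in> \<E>\<close>, and let \<open>p\<close> be a pushout of \<open>e\<close> along \<open>e\<^sub>0\<close> that lies in
  \<open>\<E>\<close>. Since \<open>m\<^sub>0 e\<^sub>0 = g e\<close>, the morphism \<open>m\<^sub>0\<close> extends along \<open>p\<close>, and \<open>p \<up> m\<^sub>0\<close> together with
  \<open>m\<^sub>0\<close> being monic forces \<open>p\<close> to have a retraction (\<open>retraction_of_up_rel\<close>). A retraction of the
  pushout of \<open>e\<close> along \<open>e\<^sub>0\<close> is the same thing as a factorization of \<open>e\<^sub>0\<close> through \<open>e\<close>.

  In both cases the relation \<open>\<sim>\<close> enters only through the fact that \<open>f \<le> g\<close> makes \<open>f\<close> factor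
  through \<open>g\<close>. The arguments are not formally dual: \<open>e\<^sub>0 \<down> p\<close> yields a section of \<open>p\<close> outright,
  whereas \<open>p \<up> m\<^sub>0\<close> only makes the extension of \<open>m\<^sub>0\<close> along \<open>p\<close> factor through \<open>m\<^sub>0\<close>, and it takes
  cancellation of \<open>m\<^sub>0\<close> to turn this into a retraction.
\<close>

lemma homI: "f \<in> Arr \<X> \<Longrightarrow> f \<in> hom \<X> (Dom \<X> f) (Cod \<X> f)"
  by (simp add: hom_def)

context category
begin

text \<open>The sieve of \<open>f\<close> contains \<open>f 1 = f\<close>, so inclusion of sieves is decided by the
  generators.\<close>

lemma mor_le_factors:
  assumes "mor_le \<X> f g"
  obtains k where "k \<in> hom \<X> (Dom \<X> f) (Dom \<X> g)" and "f = g \<cdot> k"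
proof -
  have f: "f \<in> Arr \<X>" and g: "g \<in> Arr \<X>" and sub: "sieve \<X> f \<subseteq> sieve \<X> g"
    using assms by (simp_all add: mor_le_def)
  have "Id \<X> (Dom \<X> f) \<in> hom \<X> (Dom \<X> f) (Dom \<X> f)"
    using Id_hom Dom_Obj f by simp
  moreover have "f = f \<cdot> Id \<X> (Dom \<X> f)"
    using Id_right[OF homI[OF f]] by simp
  ultimately have "f \<in> sieve \<X> f"
    unfolding sieve_def hom_def by blast
  then obtain h where h: "h \<in> Arr \<X>" "Cod \<X> h = Dom \<X> g" "f = g \<cdot> h"
    using sub unfolding sieve_def by blast
  have "h \<in> hom \<X> (Dom \<X> h) (Dom \<X> g)"
    using h by (simp add: hom_def)
  moreover from this have "Dom \<X> f = Dom \<X> h"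
    using Comp_hom[OF _ homI[OF g]] h(3) by (simp add: hom_def)
  ultimately show thesis
    using that h(3) by simp
qed

text \<open>The morphism \<open>w\<close> supplied by \<open>e \<down> m\<close> satisfies only \<open>m w \<sim> 1\<close>, but then \<open>1\<close> factors
  through \<open>m w\<close> and hence through \<open>m\<close>.\<close>

lemma section_of_down_rel:
  assumes m: "m \<in> Arr \<X>" and "down_rel \<X> e m"
    and "u \<in> hom \<X> (Dom \<X> e) (Dom \<X> m)" and "e = m \<cdot> u"
  obtains s where "s \<in> hom \<X> (Cod \<X> m) (Dom \<X> m)" and "m \<cdot> s = Id \<X> (Cod \<X> m)"
proof -
  let ?X = "Cod \<X> m"
  obtain w where w: "w \<in> hom \<X> ?X (Dom \<X> m)" and "mor_sim \<X> (m \<cdot> w) (Id \<X> ?X)"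
    using assms unfolding down_rel_def by blast
  then obtain k where k: "k \<in> hom \<X> (Dom \<X> (Id \<X> ?X)) (Dom \<X> (m \<cdot> w))"
    and eq: "Id \<X> ?X = (m \<cdot> w) \<cdot> k"
    using mor_le_factors unfolding mor_sim_def by blast
  have "Dom \<X> (Id \<X> ?X) = ?X"
    using Id_hom[OF Cod_Obj[OF m]] by (simp add: hom_def)
  moreover have "Dom \<X> (m \<cdot> w) = ?X"
    using Comp_hom[OF w homI[OF m]] by (simp add: hom_def)
  ultimately have k': "k \<in> hom \<X> ?X ?X"
    using k by simp
  show thesis
    using that[of "w \<cdot> k"] Comp_hom[OF k' w] Comp_assoc[OF k' w homI[OF m]] eq by simp
qed

text \<open>From \<open>m w \<sim> v\<close> one gets \<open>v = m w k\<close>, so that \<open>m = v e = m (w k e)\<close>; cancelling \<open>m\<close> makes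
  \<open>w k\<close> a retraction of \<open>e\<close>.\<close>

lemma retraction_of_up_rel:
  assumes mono: "monomorphism \<X> m" and "up_rel \<X> e m"
    and e: "e \<in> Arr \<X>" and dom: "Dom \<X> e = Dom \<X> m"
    and v: "v \<in> hom \<X> (Cod \<X> e) (Cod \<X> m)" and ve: "v \<cdot> e = m"
  obtains r where "r \<in> hom \<X> (Cod \<X> e) (Dom \<X> m)" and "r \<cdot> e = Id \<X> (Dom \<X> m)"
proof -
  let ?M = "Dom \<X> m" and ?E = "Cod \<X> e"
  have m: "m \<in> Arr \<X>"
    using mono by (simp add: monomorphism_def)
  have e': "e \<in> hom \<X> ?M ?E"
    using homI[OF e] dom by simp
  obtain w where w: "w \<in> hom \<X> ?E ?M" and "mor_sim \<X> (m \<cdot> w) v"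
    using assms unfolding up_rel_def by blast
  then obtain k where k: "k \<in> hom \<X> (Dom \<X> v) (Dom \<X> (m \<cdot> w))" and eq: "v = (m \<cdot> w) \<cdot> k"
    using mor_le_factors unfolding mor_sim_def by blast
  have mw: "m \<cdot> w \<in> hom \<X> ?E (Cod \<X> m)"
    using Comp_hom[OF w homI[OF m]] .
  have k': "k \<in> hom \<X> ?E ?E"
    using k v mw by (simp add: hom_def)
  have wk: "w \<cdot> k \<in> hom \<X> ?E ?M"
    using Comp_hom[OF k' w] .
  have "m \<cdot> ((w \<cdot> k) \<cdot> e) = (m \<cdot> (w \<cdot> k)) \<cdot> e"
    using Comp_assoc[OF e' wk homI[OF m]] by simp
  also have "\<dots> = m"
    using Comp_assoc[OF k' w homI[OF m]] eq ve by simp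
  also have "\<dots> = m \<cdot> Id \<X> ?M"
    using Id_right[OF homI[OF m]] by simp
  finally have "(w \<cdot> k) \<cdot> e = Id \<X> ?M"
    using mono Comp_hom[OF e' wk] Id_hom[OF Dom_Obj[OF m]]
    unfolding monomorphism_def by blast
  then show thesis
    using that wk by blast
qed

lemma factors_of_pullback_section:
  assumes pb: "is_pullback \<X> m f p q"
    and s: "s \<in> hom \<X> (Dom \<X> f) (Dom \<X> p)" and ps: "p \<cdot> s = Id \<X> (Dom \<X> f)"
  shows "q \<cdot> s \<in> hom \<X> (Dom \<X> f) (Dom \<X> m)" and "f = m \<cdot> (q \<cdot> s)"
proof -
  have m: "m \<in> Arr \<X>" and f: "f \<in> Arr \<X>"
    and p: "p \<in> hom \<X> (Dom \<X> p) (Dom \<X> f)" and q: "q \<in> hom \<X> (Dom \<X> p) (Dom \<X> m)"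
    and sq: "f \<cdot> p = m \<cdot> q"
    using pb unfolding is_pullback_def by blast+
  show "q \<cdot> s \<in> hom \<X> (Dom \<X> f) (Dom \<X> m)"
    using Comp_hom[OF s q] .
  have "f = f \<cdot> (p \<cdot> s)"
    using Id_right[OF homI[OF f]] ps by simp
  also have "\<dots> = (m \<cdot> q) \<cdot> s"
    using Comp_assoc[OF s p homI[OF f]] sq by simp
  also have "\<dots> = m \<cdot> (q \<cdot> s)"
    using Comp_assoc[OF s q homI[OF m]] .
  finally show "f = m \<cdot> (q \<cdot> s)" .
qed

lemma factors_of_pushout_retraction:
  assumes po: "is_pushout \<X> e f p q"
    and r: "r \<in> hom \<X> (Cod \<X> p) (Cod \<X> f)" and rp: "r \<cdot> p = Id \<X> (Cod \<X> f)"
  shows "r \<cdot> q \<in> hom \<X> (Cod \<X> e) (Cod \<X> f)" and "f = (r \<cdot> q) \<cdot> e"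
proof -
  have e: "e \<in> Arr \<X>" and f: "f \<in> Arr \<X>"
    and p: "p \<in> hom \<X> (Cod \<X> f) (Cod \<X> p)" and q: "q \<in> hom \<X> (Cod \<X> e) (Cod \<X> p)"
    and sq: "p \<cdot> f = q \<cdot> e"
    using po unfolding is_pushout_def by blast+
  show "r \<cdot> q \<in> hom \<X> (Cod \<X> e) (Cod \<X> f)"
    using Comp_hom[OF q r] .
  have "f = (r \<cdot> p) \<cdot> f"
    using Id_left[OF homI[OF f]] rp by simp
  also have "\<dots> = r \<cdot> (q \<cdot> e)"
    using Comp_assoc[OF homI[OF f] p r] sq by simp
  also have "\<dots> = (r \<cdot> q) \<cdot> e"
    using Comp_assoc[OF homI[OF e] q r] by simp
  finally show "f = (r \<cdot> q) \<cdot> e" .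
qed

lemma quasi_factorization_obtain:
  assumes qfs: "quasi_factorization_structure \<X> \<E> \<M>" and f: "f \<in> Arr \<X>"
  obtains e m where "e \<in> \<E>" "m \<in> \<M>" "f = m \<cdot> e"
    and "e \<in> hom \<X> (Dom \<X> f) (Dom \<X> m)" "m \<in> hom \<X> (Dom \<X> m) (Cod \<X> f)"
proof -
  obtain e m where em: "e \<in> \<E>" "m \<in> \<M>" "Cod \<X> e = Dom \<X> m" "f = m \<cdot> e"
    using qfs f unfolding quasi_factorization_structure_def by blast
  have arr: "e \<in> Arr \<X>" "m \<in> Arr \<X>"
    using em qfs unfolding quasi_factorization_structure_def by blast+
  have "f \<in> hom \<X> (Dom \<X> e) (Cod \<X> m)"
    using Comp_hom[OF _ homI[OF arr(2)], of e "Dom \<X> e"] homI[OF arr(1)] em by simp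
  then show thesis
    using that em arr by (simp add: hom_def)
qed

lemma quasi_right_factorizations_if_pullbacks:
  assumes qfs: "quasi_factorization_structure \<X> \<E> \<M>" and pbs: "has_pullbacks \<X> \<M>"
  shows "quasi_right_factorizations \<X> \<M>"
  unfolding quasi_right_factorizations_def
proof
  fix f assume "f \<in> Arr \<X>"
  then obtain e\<^sub>0 m\<^sub>0 where e0: "e\<^sub>0 \<in> \<E>" and m0: "m\<^sub>0 \<in> \<M>" and f: "f = m\<^sub>0 \<cdot> e\<^sub>0"
    and e0h: "e\<^sub>0 \<in> hom \<X> (Dom \<X> f) (Dom \<X> m\<^sub>0)" and m0h: "m\<^sub>0 \<in> hom \<X> (Dom \<X> m\<^sub>0) (Cod \<X> f)"
    using quasi_factorization_obtain[OF qfs] by blast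
  have "\<exists>h \<in> hom \<X> (Dom \<X> m\<^sub>0) (Dom \<X> m). m\<^sub>0 = m \<cdot> h"
    if m: "m \<in> \<M>" "Cod \<X> m = Cod \<X> f" and g: "g \<in> hom \<X> (Dom \<X> f) (Dom \<X> m)" "f = m \<cdot> g"
    for m g
  proof -
    have "m\<^sub>0 \<in> Arr \<X>" "Cod \<X> m\<^sub>0 = Cod \<X> m"
      using m0h m by (simp_all add: hom_def)
    then obtain p q where pb: "is_pullback \<X> m m\<^sub>0 p q" and p: "p \<in> \<M>"
      using pbs m(1) unfolding has_pullbacks_def by blast
    have parr: "p \<in> Arr \<X>" and pcod: "Cod \<X> p = Dom \<X> m\<^sub>0"
      using pb unfolding is_pullback_def hom_def by blast+
    obtain u where "u \<in> hom \<X> (Dom \<X> f) (Dom \<X> p)" and u: "p \<cdot> u = e\<^sub>0"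
      using pb e0h g f unfolding is_pullback_def by metis
    then have u': "u \<in> hom \<X> (Dom \<X> e\<^sub>0) (Dom \<X> p)"
      using e0h by (simp add: hom_def)
    have "down_rel \<X> e\<^sub>0 p"
      using qfs e0 p e0h pcod
      unfolding quasi_factorization_structure_def down_class_def hom_def by auto
    from section_of_down_rel[OF parr this u' u[symmetric]]
    obtain s where s: "s \<in> hom \<X> (Dom \<X> m\<^sub>0) (Dom \<X> p)" "p \<cdot> s = Id \<X> (Dom \<X> m\<^sub>0)"
      using pcod by metis
    show ?thesis
      using factors_of_pullback_section[OF pb s] by blast
  qed
  moreover have "Cod \<X> m\<^sub>0 = Cod \<X> f"
    using m0h by (simp add: hom_def)
  ultimately show "\<exists>m\<^sub>f \<in> \<M>. Cod \<X> m\<^sub>f = Cod \<X> f \<and>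
      (\<exists>g \<in> hom \<X> (Dom \<X> f) (Dom \<X> m\<^sub>f). f = m\<^sub>f \<cdot> g) \<and>
      (\<forall>m \<in> \<M>. Cod \<X> m = Cod \<X> f \<and> (\<exists>g \<in> hom \<X> (Dom \<X> f) (Dom \<X> m). f = m \<cdot> g) \<longrightarrow>
         (\<exists>h \<in> hom \<X> (Dom \<X> m\<^sub>f) (Dom \<X> m). m\<^sub>f = m \<cdot> h))"
    using m0 e0h f by blast
qed

lemma quasi_left_factorizations_if_pushouts:
  assumes qfs: "quasi_factorization_structure \<X> \<E> \<M>"
    and mono: "\<And>m. m \<in> \<M> \<Longrightarrow> monomorphism \<X> m" and pos: "has_pushouts \<X> \<E>"
  shows "quasi_left_factorizations \<X> \<E>"
  unfolding quasi_left_factorizations_def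
proof
  fix f assume "f \<in> Arr \<X>"
  then obtain e\<^sub>0 m\<^sub>0 where e0: "e\<^sub>0 \<in> \<E>" and m0: "m\<^sub>0 \<in> \<M>" and f: "f = m\<^sub>0 \<cdot> e\<^sub>0"
    and e0h: "e\<^sub>0 \<in> hom \<X> (Dom \<X> f) (Dom \<X> m\<^sub>0)" and m0h: "m\<^sub>0 \<in> hom \<X> (Dom \<X> m\<^sub>0) (Cod \<X> f)"
    using quasi_factorization_obtain[OF qfs] by blast
  have cod0: "Cod \<X> e\<^sub>0 = Dom \<X> m\<^sub>0"
    using e0h by (simp add: hom_def)
  have "\<exists>h \<in> hom \<X> (Cod \<X> e) (Cod \<X> e\<^sub>0). e\<^sub>0 = h \<cdot> e"
    if e: "e \<in> \<E>" "Dom \<X> e = Dom \<X> f" and g: "g \<in> hom \<X> (Cod \<X> e) (Cod \<X> f)" "f = g \<cdot> e"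
    for e g
  proof -
    have "e\<^sub>0 \<in> Arr \<X>" "Dom \<X> e\<^sub>0 = Dom \<X> e"
      using e0h e by (simp_all add: hom_def)
    then obtain p q where po: "is_pushout \<X> e e\<^sub>0 p q" and p: "p \<in> \<E>"
      using pos e(1) unfolding has_pushouts_def by blast
    have parr: "p \<in> Arr \<X>" and pdom: "Dom \<X> p = Dom \<X> m\<^sub>0"
      using po cod0 unfolding is_pushout_def hom_def by auto
    have "m\<^sub>0 \<in> hom \<X> (Cod \<X> e\<^sub>0) (Cod \<X> f)"
      using m0h cod0 by simp
    then obtain v where "v \<in> hom \<X> (Cod \<X> p) (Cod \<X> f)" and v: "v \<cdot> p = m\<^sub>0"
      using po g f unfolding is_pushout_def by metis
    then have v': "v \<in> hom \<X> (Cod \<X> p) (Cod \<X> m\<^sub>0)"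
      using m0h by (simp add: hom_def)
    have "up_rel \<X> p m\<^sub>0"
      using qfs m0 p pdom
      unfolding quasi_factorization_structure_def up_class_def by auto
    from retraction_of_up_rel[OF mono[OF m0] this parr pdom v' v]
    obtain r where r: "r \<in> hom \<X> (Cod \<X> p) (Cod \<X> e\<^sub>0)" "r \<cdot> p = Id \<X> (Cod \<X> e\<^sub>0)"
      using cod0 by metis
    show ?thesis
      using factors_of_pushout_retraction[OF po r] by blast
  qed
  moreover have "Dom \<X> e\<^sub>0 = Dom \<X> f" "m\<^sub>0 \<in> hom \<X> (Cod \<X> e\<^sub>0) (Cod \<X> f)"
    using e0h m0h cod0 by (simp_all add: hom_def)
  ultimately show "\<exists>e\<^sub>f \<in> \<E>. Dom \<X> e\<^sub>f = Dom \<X> f \<and>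
      (\<exists>g \<in> hom \<X> (Cod \<X> e\<^sub>f) (Cod \<X> f). f = g \<cdot> e\<^sub>f) \<and>
      (\<forall>e \<in> \<E>. Dom \<X> e = Dom \<X> f \<and> (\<exists>g \<in> hom \<X> (Cod \<X> e) (Cod \<X> f). f = g \<cdot> e) \<longrightarrow>
         (\<exists>h \<in> hom \<X> (Cod \<X> e) (Cod \<X> e\<^sub>f). e\<^sub>f = h \<cdot> e))"
    using e0 f by blast
qed

end

theorem theorem5p11:
  fixes \<X> :: "('o, 'a) cat" and \<E> \<M> :: "'a set"
  assumes "category \<X>"
    and "quasi_factorization_structure \<X> \<E> \<M>"
  shows "(has_pullbacks \<X> \<M> \<longrightarrow> quasi_right_factorizations \<X> \<M>) \<and>
    ((\<forall>m \<in> \<M>. monomorphism \<X> m) \<and> has_pushouts \<X> \<E> \<longrightarrow> quasi_left_factorizations \<X> \<E>)"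
  using category.quasi_right_factorizations_if_pullbacks[OF assms]
    category.quasi_left_factorizations_if_pushouts[OF assms]
  by blast

end
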